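(* There exist families $(T_{I,k})_{k\in\mathbb{N}}$ and $(T_{F,k})_{k\in\mathbb{N}}$ such that, for each $k$, $T_{I,k}$ and $T_{F,k}$ are plane spanning trees of a common set of $10k+2$ points in convex position in the plane, and the minimum length of a flip sequence from $T_{I,k}$ to $T_{F,k}$ that only uses parking edges from the convex hull is larger by at least $k$ than the minimum length of a flip sequence from $T_{I,k}$ to $T_{F,k}$.
   Context: Let $P\subset\mathbb{R}^2$ be a finite set of points in convex position. Edges are straight-line segments $uv$ between distinct points $u,v\in P$. A convex hull edge joins two points adjacent on the boundary of the convex hull of $P$. Two edges cross if their segments meet in a point other than a common endpoint. A plane spanning tree of $P$ ($|P|=n$) is a set of $n-1$ pairwise non-crossing edges forming a tree on the vertex set $P$. A flip $e\to f$ in a plane spanning tree $T$ removes an edge $e\in T$ and adds an edge $f\notin T$ such that $T-e+f$ is again a plane spanning tree of $P$ (the edges $e$ and $f$ may cross). A flip sequence from $T_I$ to $T_F$ is a sequence of plane spanning trees $T_I=T_0,T_1,\dots,T_m=T_F$ in which consecutive trees differ by a single flip; its length is $m$. The parking edges of a flip sequence are the edges that occur in some tree of the sequence but belong to neither $T_I$ nor $T_F$. A flip sequence only uses parking edges from the convex hull if every edge of every $T_i$ lies in $T_I\cup T_F$ or is a convex hull edge. *)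

theory Defs
  imports "HOL-Analysis.Analysis"
begin

(* The edge uv is the two-element set {u, v}; the segment it spans is convex hull {u, v}. *)
type_synonym edge = "(real ^ 2) set"

definition convex_position :: "(real ^ 2) set \<Rightarrow> bool" where
  "convex_position P \<longleftrightarrow> (\<forall>p\<in>P. p \<notin> convex hull (P - {p}))"

definition edges_on :: "(real ^ 2) set \<Rightarrow> edge set" where
  "edges_on P = {{u, v} | u v. u \<in> P \<and> v \<in> P \<and> u \<noteq> v}"

(* Two vertices of a convex polygon are adjacent on its boundary iff their segment is a
   one-dimensional face. If P has just two points, the hull is itself a segment, and this
   segment is a hull edge. *)
definition hull_edges :: "(real ^ 2) set \<Rightarrow> edge set" where
  "hull_edges P = {e \<in> edges_on P. (convex hull e) edge_of (convex hull P)}"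

(* Intended for distinct edges e and f, so that e \<inter> f is the set of their common endpoints. *)
definition crosses :: "edge \<Rightarrow> edge \<Rightarrow> bool" where
  "crosses e f \<longleftrightarrow> (\<exists>x \<in> convex hull e \<inter> convex hull f. x \<notin> e \<inter> f)"

definition connected_graph :: "'a set \<Rightarrow> 'a set set \<Rightarrow> bool" where
  "connected_graph V E \<longleftrightarrow> (\<forall>u\<in>V. \<forall>v\<in>V. (u, v) \<in> {(x, y). {x, y} \<in> E}\<^sup>*)"

definition is_cycle :: "'a set set \<Rightarrow> 'a list \<Rightarrow> bool" where
  "is_cycle E vs \<longleftrightarrow> length vs \<ge> 3 \<and> distinct vs \<and>
     (\<forall>i < length vs. {vs ! i, vs ! (Suc i mod length vs)} \<in> E)"

definition is_tree :: "'a set \<Rightarrow> 'a set set \<Rightarrow> bool" where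
  "is_tree V E \<longleftrightarrow> connected_graph V E \<and> (\<nexists>vs. is_cycle E vs)"

definition plane_spanning_tree :: "(real ^ 2) set \<Rightarrow> edge set \<Rightarrow> bool" where
  "plane_spanning_tree P T \<longleftrightarrow>
     T \<subseteq> edges_on P \<and> card T = card P - 1 \<and>
     pairwise (\<lambda>e f. \<not> crosses e f) T \<and> is_tree P T"

definition flip :: "(real ^ 2) set \<Rightarrow> edge set \<Rightarrow> edge set \<Rightarrow> bool" where
  "flip P T T' \<longleftrightarrow> plane_spanning_tree P T \<and> plane_spanning_tree P T' \<and>
     (\<exists>e f. e \<in> T \<and> f \<notin> T \<and> T' = insert f (T - {e}))"

(* The trees of the sequence are T 0, ..., T m; the values of T beyond m are irrelevant. *)
definition flip_sequence ::
    "(real ^ 2) set \<Rightarrow> edge set \<Rightarrow> edge set \<Rightarrow> nat \<Rightarrow> (nat \<Rightarrow> edge set) \<Rightarrow> bool" where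
  "flip_sequence P TI TF m T \<longleftrightarrow>
     T 0 = TI \<and> T m = TF \<and>
     (\<forall>i\<le>m. plane_spanning_tree P (T i)) \<and> (\<forall>i<m. flip P (T i) (T (Suc i)))"

definition hull_parking_flip_sequence ::
    "(real ^ 2) set \<Rightarrow> edge set \<Rightarrow> edge set \<Rightarrow> nat \<Rightarrow> (nat \<Rightarrow> edge set) \<Rightarrow> bool" where
  "hull_parking_flip_sequence P TI TF m T \<longleftrightarrow>
     flip_sequence P TI TF m T \<and>
     (\<forall>i\<le>m. \<forall>e\<in>T i. e \<in> TI \<union> TF \<or> e \<in> hull_edges P)"

definition is_minimum :: "nat set \<Rightarrow> nat \<Rightarrow> bool" where
  "is_minimum A d \<longleftrightarrow> d \<in> A \<and> (\<forall>m\<in>A. d \<le> m)"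

definition is_min_flip_length ::
    "(real ^ 2) set \<Rightarrow> edge set \<Rightarrow> edge set \<Rightarrow> nat \<Rightarrow> bool" where
  "is_min_flip_length P TI TF d \<longleftrightarrow> is_minimum {m. \<exists>T. flip_sequence P TI TF m T} d"

definition is_min_hull_parking_flip_length ::
    "(real ^ 2) set \<Rightarrow> edge set \<Rightarrow> edge set \<Rightarrow> nat \<Rightarrow> bool" where
  "is_min_hull_parking_flip_length P TI TF d \<longleftrightarrow>
     is_minimum {m. \<exists>T. hull_parking_flip_sequence P TI TF m T} d"

end

theory Submission
  imports Defs
begin

text \<open>
  The trees are chains of \<open>k\<close> copies of a 12-vertex gadget found by computer search; consecutive
  copies share an edge that belongs to both trees. Label the gadget \<open>0, \<dots>, 11\<close> around its boundary.
  Besides four common boundary edges, \<open>T_I\<close> has \<open>{1-3, 1-4, 1-6, 6-11, 7-11, 7-10, 8-10}\<close> and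
  \<open>T_F\<close> has \<open>{0-10, 1-9, 1-10, 2-7, 2-9, 4-7, 5-7}\<close>; parking at the diagonal \<open>1-7\<close> gives 8 flips.

  With parking restricted to the hull, each gadget needs two parking edges. Every new edge crosses
  \<open>6-11\<close> and one of \<open>1-6\<close>, \<open>7-11\<close>, so before the first new edge appears one of these three is
  missing, and only the hull edges \<open>0-1, 6-7, 10-11, 4-5\<close> can repair the connectivity. Symmetrically,
  when the last old edge disappears one of \<open>2-9, 1-9, 2-7\<close> is still missing, and only
  \<open>7-8, 1-2, 9-10, 3-4\<close> help. These sets are disjoint, and the number of flips is at least the
  number of edges that ever occur outside \<open>T_I\<close>, hence at least \<open>(7 + 2) k\<close>.

  The points lie on the parabola \<open>y = x^2\<close>, so chords cross iff their abscissae interleave. In the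
  formal text, the labels \<open>6, \<dots>, 11\<close> become \<open>-6, \<dots>, -1\<close>.
\<close>

section \<open>Chords of the parabola\<close>

definition pt :: "int \<Rightarrow> real ^ 2" where
  "pt x = vector [of_int x, (of_int x)\<^sup>2]"

lemma pt_nth [simp]: "pt x $ 1 = of_int x" "pt x $ 2 = (of_int x)\<^sup>2"
  by (simp_all add: pt_def)

lemma pt_eq_iff [simp]: "pt x = pt y \<longleftrightarrow> x = y"
  by (metis of_int_eq_iff pt_nth(1))

lemma inj_pt: "inj pt"
  by (simp add: inj_def)

(* Vanishes on the line through pt a and pt b (the tangent if a = b). *)
definition secant :: "int \<Rightarrow> int \<Rightarrow> real ^ 2 \<Rightarrow> real" where
  "secant a b z = z $ 2 - of_int (a + b) * z $ 1 + of_int (a * b)"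

lemma secant_pt: "secant a b (pt x) = of_int ((x - a) * (x - b))"
  by (simp add: secant_def power2_eq_square algebra_simps)

lemma secant_convex_combination:
  "u + v = 1 \<Longrightarrow> secant a b (u *\<^sub>R y + v *\<^sub>R z) = u * secant a b y + v * secant a b z"
proof -
  assume "u + v = 1"
  then have u: "u = 1 - v" by simp
  show ?thesis unfolding u by (simp add: secant_def algebra_simps)
qed

lemma convex_secant_pos: "convex {z. 0 < secant a b z}"
proof (rule convexI)
  fix x y and u v :: real
  assume "x \<in> {z. 0 < secant a b z}" "y \<in> {z. 0 < secant a b z}" "0 \<le> u" "0 \<le> v" "u + v = 1"
  then show "u *\<^sub>R x + v *\<^sub>R y \<in> {z. 0 < secant a b z}"
    by (cases "u = 0") (auto simp: secant_convex_combination intro!: add_pos_nonneg)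
qed

lemma convex_hull_pair_iff:
  "z \<in> convex hull {x, y :: real ^ 2} \<longleftrightarrow> (\<exists>u\<ge>0. \<exists>v\<ge>0. u + v = 1 \<and> z = u *\<^sub>R x + v *\<^sub>R y)"
  by (auto simp: convex_hull_2)

lemma secant_on_chord: "z \<in> convex hull {pt a, pt b} \<Longrightarrow> secant a b z = 0"
  by (auto simp: convex_hull_pair_iff secant_convex_combination secant_pt)

text \<open>The tangent at \<open>pt a\<close>, the zero set of \<open>secant a a\<close>, has every
  other point of the parabola strictly above it.\<close>

lemma convex_position_parabola: "convex_position (pt ` A)"
  unfolding convex_position_def
proof
  fix p assume "p \<in> pt ` A"
  then obtain a where a: "p = pt a" by auto
  have "pt ` A - {p} \<subseteq> {z. 0 < secant a a z}"
    by (auto simp: a secant_pt mult_less_0_iff zero_less_mult_iff)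
  then have "convex hull (pt ` A - {p}) \<subseteq> {z. 0 < secant a a z}"
    using convex_secant_pos by (rule hull_minimal)
  then show "p \<notin> convex hull (pt ` A - {p})"
    by (auto simp: a secant_pt)
qed

lemma chords_meet:
  assumes "a < c" "c < b" "b < d"
  obtains z where "z \<in> open_segment (pt a) (pt b)" "z \<in> open_segment (pt c) (pt d)"
proof -
  define A B C D :: real where "A = of_int a" and "B = of_int b" and "C = of_int c" and "D = of_int d"
  have o: "A < C" "C < B" "B < D" using assms by (simp_all add: A_def B_def C_def D_def)
  \<comment> \<open>Abscissa of the intersection of the lines y = (A + B) x - A B and y = (C + D) x
    - C D.\<close>
  define s where "s = (C * D - A * B) / (C + D - A - B)"
  have n: "C + D - A - B > 0" using o by simp
  have "s - C = (C - A) * (B - C) / (C + D - A - B)" "B - s = (B - C) * (D - B) / (C + D - A - B)"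
    using n by (simp_all add: s_def field_simps)
  then have s: "C < s" "s < B" using n o
    by (smt (verit) divide_pos_pos mult_pos_pos)+
  have ss: "s * (C + D - A - B) = C * D - A * B" using n by (simp add: s_def)
  \<comment> \<open>Affine parameters of the abscissa \<open>s\<close> on the two chords.\<close>
  define u where "u = (s - A) / (B - A)"
  define v where "v = (s - C) / (D - C)"
  have u: "u * (B - A) = s - A" and v: "v * (D - C) = s - C" using o by (simp_all add: u_def v_def)
  have "(1 - u) *\<^sub>R pt a + u *\<^sub>R pt b = vector [s, (A + B) * s - A * B]"
  proof -
    have "(1 - u) * A + u * B = s" using u by (simp add: algebra_simps)
    moreover have "(1 - u) * A\<^sup>2 + u * B\<^sup>2 = A\<^sup>2 + (u * (B - A)) * (A + B)"
      by (simp add: algebra_simps power2_eq_square)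
    then have "(1 - u) * A\<^sup>2 + u * B\<^sup>2 = (A + B) * s - A * B"
      unfolding u by (simp add: algebra_simps power2_eq_square)
    ultimately show ?thesis by (simp add: vec_eq_iff forall_2 A_def B_def)
  qed
  moreover have "(1 - v) *\<^sub>R pt c + v *\<^sub>R pt d = vector [s, (A + B) * s - A * B]"
  proof -
    have "(1 - v) * C + v * D = s" using v by (simp add: algebra_simps)
    moreover have "(1 - v) * C\<^sup>2 + v * D\<^sup>2 = C\<^sup>2 + (v * (D - C)) * (C + D)"
      by (simp add: algebra_simps power2_eq_square)
    then have "(1 - v) * C\<^sup>2 + v * D\<^sup>2 = (C + D) * s - C * D"
      unfolding v by (simp add: algebra_simps power2_eq_square)
    then have "(1 - v) * C\<^sup>2 + v * D\<^sup>2 = (A + B) * s - A * B"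
      using ss by (simp add: algebra_simps)
    ultimately show ?thesis by (simp add: vec_eq_iff forall_2 C_def D_def)
  qed
  moreover have "0 < u" "u < 1" "0 < v" "v < 1" using s o by (simp_all add: u_def v_def field_simps)
  moreover have "pt a \<noteq> pt b" "pt c \<noteq> pt d" using assms by auto
  ultimately show ?thesis using that unfolding in_segment(2) by metis
qed

section \<open>Crossing criterion for chords\<close>

lemma crosses_interleaved:
  assumes "a < c" "c < b" "b < d"
  shows "crosses {pt a, pt b} {pt c, pt d}"
proof -
  obtain z where "z \<in> open_segment (pt a) (pt b)" "z \<in> open_segment (pt c) (pt d)"
    using chords_meet[OF assms] .
  then show ?thesis using assms
    unfolding crosses_def segment_convex_hull[symmetric]
    by (intro bexI[of _ z]) (auto dest: open_closed_segment)
qed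

lemma crosses_commute: "crosses e f \<longleftrightarrow> crosses f e"
  by (auto simp: crosses_def)

text \<open>Without interleaving, \<open>secant a b\<close> has the same weak sign at
  \<open>pt c\<close> and \<open>pt d\<close>. It vanishes at a common point of the chords, so every
  end of the second chord with positive weight there is \<open>pt a\<close> or \<open>pt b\<close>:
  the point is a common endpoint, or the chords coincide.\<close>

lemma not_crosses:
  assumes "a < b" "c < d" "\<not> (a < c \<and> c < b \<and> b < d)" "\<not> (c < a \<and> a < d \<and> d < b)"
    and ne: "(a, b) \<noteq> (c, d)"
  shows "\<not> crosses {pt a, pt b} {pt c, pt d}"
  unfolding crosses_def
proof (intro notI, elim bexE)
  fix z assume z: "z \<in> convex hull {pt a, pt b} \<inter> convex hull {pt c, pt d}"
    "z \<notin> {pt a, pt b} \<inter> {pt c, pt d}"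
  then obtain u v where uv: "0 \<le> u" "0 \<le> v" "u + v = 1" "z = u *\<^sub>R pt c + v *\<^sub>R pt d"
    by (auto simp: convex_hull_pair_iff)
  let ?q = "secant a b"
  have zero: "u * ?q (pt c) + v * ?q (pt d) = 0"
    using secant_on_chord[of z a b] z uv by (simp add: secant_convex_combination)
  have "(0 \<le> ?q (pt c) \<and> 0 \<le> ?q (pt d)) \<or> (?q (pt c) \<le> 0 \<and> ?q (pt d) \<le> 0)"
    unfolding secant_pt of_int_0_le_iff of_int_le_0_iff zero_le_mult_iff mult_le_0_iff
    using assms by linarith
  then have *: "u * ?q (pt c) = 0 \<and> v * ?q (pt d) = 0"
    using zero uv
    by (smt (verit) mult_nonneg_nonneg mult_nonneg_nonpos)
  have q0: "?q (pt x) = 0 \<Longrightarrow> x = a \<or> x = b" for x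
    by (auto simp: secant_pt)
  consider "u = 0" | "v = 0" | "u \<noteq> 0" "v \<noteq> 0" by blast
  then show False
  proof cases
    case 1
    then have "v = 1" using uv by simp
    then show False using 1 uv z * q0[of d] by auto
  next
    case 2
    then have "u = 1" using uv by simp
    then show False using 2 uv z * q0[of c] by auto
  next
    case 3
    then show False using * q0[of c] q0[of d] assms by auto
  qed
qed

section \<open>Boundary edges of the convex hull\<close>

text \<open>The line through the two points supports the hull: no integer lies strictly between
  \<open>x\<close> and \<open>x + 1\<close>, so \<open>secant\<close> is positive at every other
  point.\<close>

lemma hull_edge_consecutive:
  assumes "x \<in> A" "x + 1 \<in> A"
  shows "{pt x, pt (x + 1)} \<in> hull_edges (pt ` A)"
proof -
  let ?P = "pt ` A" and ?e = "{pt x, pt (x + 1)}" and ?q = "secant x (x + 1)"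
  have pos: "0 < ?q (pt y)" if "y \<noteq> x" "y \<noteq> x + 1" for y
    unfolding secant_pt of_int_0_less_iff zero_less_mult_iff using that by linarith
  have rest: "convex hull (?P - ?e) \<subseteq> {z. 0 < ?q z}"
    using pos by (intro hull_minimal convex_secant_pos) auto
  \<comment> \<open>A normal vector of the line; it puts \<open>secant\<close> into the
    inner-product form of the supporting hyperplane criterion for faces.\<close>
  define w :: "real ^ 2" where "w = vector [- of_int (x + (x + 1)), 1]"
  have qw: "?q z = w \<bullet> z + of_int (x * (x + 1))" for z
    by (simp add: w_def secant_def inner_vec_def sum_2 algebra_simps)
  have ge: "0 \<le> ?q z" if "z \<in> convex hull ?P" for z
  proof -
    have "?P \<subseteq> {z. - of_int (x * (x + 1)) \<le> w \<bullet> z}"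
    proof clarify
      fix y
      have "0 \<le> ?q (pt y)" using pos[of y] by (cases "y = x \<or> y = x + 1") (auto simp: secant_pt)
      then show "- of_int (x * (x + 1)) \<le> w \<bullet> pt y" using qw[of "pt y"] by linarith
    qed
    then have "convex hull ?P \<subseteq> {z. - of_int (x * (x + 1)) \<le> w \<bullet> z}"
      using convex_halfspace_ge by (rule hull_minimal)
    then show ?thesis using that qw[of z] by auto
  qed
  have "convex hull ?P \<inter> {z. w \<bullet> z = - of_int (x * (x + 1))} face_of convex hull ?P"
    using ge qw by (intro face_of_Int_supporting_hyperplane_ge) (auto, smt (verit))
  moreover have "convex hull ?P \<inter> {z. w \<bullet> z = - of_int (x * (x + 1))} = convex hull ?e"
  proof (intro equalityI subsetI)
    fix z assume "z \<in> convex hull ?e"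
    moreover have "?e \<subseteq> ?P" using assms by auto
    ultimately show "z \<in> convex hull ?P \<inter> {z. w \<bullet> z = - of_int (x * (x + 1))}"
      using secant_on_chord[of z] qw[of z] hull_mono[of ?e ?P convex] by auto
  next
    fix z assume "z \<in> convex hull ?P \<inter> {z. w \<bullet> z = - of_int (x * (x + 1))}"
    then have z: "z \<in> convex hull ?P" "?q z = 0" using qw[of z] by auto
    show "z \<in> convex hull ?e"
    \<comment> \<open>Splitting a hull point between the chord and the hull of the remaining points
      requires that points remain.\<close>
    proof (cases "?P - ?e = {}")
      case True
      then have "?P \<subseteq> ?e" by auto
      then show ?thesis using z hull_mono[of ?P ?e convex] by auto
    next
      case False
      have "convex hull ?P = convex hull (?e \<union> (?P - ?e))"
        using assms by (intro arg_cong[of _ _ "\<lambda>S. convex hull S"]) auto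
      also have "\<dots> = convex hull (convex hull ?e \<union> convex hull (?P - ?e))"
        by (rule hull_Un) (auto intro: convex_Inter)
      finally obtain s t u v where uv: "s \<in> convex hull ?e" "t \<in> convex hull (?P - ?e)"
        "0 \<le> u" "0 \<le> v" "u + v = 1" "z = u *\<^sub>R s + v *\<^sub>R t"
        using z(1) convex_hull_union_two[of "convex hull ?e" "convex hull (?P - ?e)"] False
        by auto
      \<comment> \<open>\<open>secant\<close> is positive on the hull of the remaining points, so
        its vanishing at \<open>z\<close> leaves that hull no weight.\<close>
      then have "v * ?q t = 0"
        using z(2) secant_on_chord[of s] by (simp add: secant_convex_combination)
      then have "v = 0" using uv rest by auto
      then show ?thesis using uv by auto
    qed
  qed
  ultimately have "convex hull ?e face_of convex hull ?P" by simp
  moreover have "aff_dim (convex hull ?e) = 1"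
    by (simp add: aff_dim_convex_hull)
  moreover have "?e \<in> edges_on ?P"
    using assms unfolding edges_on_def
    by (intro CollectI exI[of _ "pt x"] exI[of _ "pt (x + 1)"]) auto
  ultimately show ?thesis by (simp add: hull_edges_def edge_of_def)
qed

text \<open>Otherwise some vertex \<open>c\<close> lies strictly between \<open>x\<close> and
  \<open>y\<close> and some \<open>d\<close> outside, and the chord joining them meets the given
  edge. A face containing an inner point of a segment contains its ends, which puts
  \<open>pt c\<close> into the hull of other points.\<close>

lemma hull_edge_cases:
  assumes e: "{pt x, pt y} \<in> hull_edges (pt ` {lo..hi})" and "x < y" "x \<in> {lo..hi}" "y \<in> {lo..hi}"
  shows "y = x + 1 \<or> (x = lo \<and> y = hi)"
proof (rule ccontr)
  let ?P = "pt ` {lo..hi}"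
  assume "\<not> ?thesis"
  then have "x + 1 \<in> {lo..hi}" "x < x + 1" "x + 1 < y"
    "(lo \<in> {lo..hi} \<and> lo < x) \<or> (hi \<in> {lo..hi} \<and> y < hi)"
    using assms(2-4) by auto
  then obtain c d where cd: "c \<in> {lo..hi}" "d \<in> {lo..hi}" "x < c" "c < y" "d < x \<or> y < d"
    by blast
  have face: "convex hull {pt x, pt y} face_of convex hull ?P"
    using e by (auto simp: hull_edges_def edge_of_def)
  have "\<exists>z \<in> convex hull {pt x, pt y}. z \<in> open_segment (pt c) (pt d)"
    using cd(5)
  proof
    assume "y < d"
    from chords_meet[OF cd(3,4) this] show ?thesis
      unfolding segment_convex_hull[symmetric] by (metis open_closed_segment)
  next
    assume "d < x"
    from chords_meet[OF this cd(3,4)] show ?thesis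
      unfolding segment_convex_hull[symmetric] by (metis open_closed_segment open_segment_commute)
  qed
  moreover have "pt c \<in> convex hull ?P" "pt d \<in> convex hull ?P"
    using cd by (auto intro: hull_inc)
  ultimately have "pt c \<in> convex hull {pt x, pt y}"
    using face unfolding face_of_def by blast
  moreover have "{pt x, pt y} \<subseteq> ?P - {pt c}" using assms cd by auto
  ultimately have "pt c \<in> convex hull (?P - {pt c})" using hull_mono by blast
  then show False using convex_position_parabola[of "{lo..hi}"] cd by (auto simp: convex_position_def)
qed

section \<open>Trees\<close>

text \<open>Every vertex other than a root \<open>r\<close> has an edge to a vertex closer to
  \<open>r\<close>, and these parent edges are distinct.\<close>

lemma connected_graph_card:
  assumes "finite V" "finite E" "connected_graph V E"
  shows "card V \<le> card E + 1"
proof (cases "V = {}")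
  case False
  then obtain r where r: "r \<in> V" by auto
  let ?R = "{(x, y). {x, y} \<in> E}"
  define d where "d v = (LEAST n. (r, v) \<in> ?R ^^ n)" for v
  have "\<exists>p. {p, v} \<in> E \<and> d p < d v" if "v \<in> V - {r}" for v
  proof -
    have "(r, v) \<in> ?R\<^sup>*" using assms(3) that r by (auto simp: connected_graph_def)
    then obtain n where "(r, v) \<in> ?R ^^ n" by (auto simp: rtrancl_power)
    then have dv: "(r, v) \<in> ?R ^^ d v" unfolding d_def by (rule LeastI)
    then have "d v \<noteq> 0" using that by (intro notI) simp
    then obtain q where q: "d v = Suc q" by (cases "d v") auto
    then obtain p where "(r, p) \<in> ?R ^^ q" "{p, v} \<in> E" using dv by auto
    then show ?thesis using q Least_le[of "\<lambda>n. (r, p) \<in> ?R ^^ n" q] by (auto simp: d_def[of p])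
  qed
  then obtain p where p: "\<And>v. v \<in> V - {r} \<Longrightarrow> {p v, v} \<in> E \<and> d (p v) < d v" by metis
  have "inj_on (\<lambda>v. {p v, v}) (V - {r})"
  proof (rule inj_onI)
    fix v w assume "v \<in> V - {r}" "w \<in> V - {r}" "{p v, v} = {p w, w}"
    \<comment> \<open>If \<open>v \<noteq> w\<close>, each would be the parent of the other, and
      \<open>d\<close> would decrease both ways.\<close>
    then show "v = w" using p[of v] p[of w] by (auto simp: doubleton_eq_iff)
  qed
  moreover have "(\<lambda>v. {p v, v}) ` (V - {r}) \<subseteq> E" using p by auto
  ultimately have "card (V - {r}) \<le> card E" using assms(2) by (metis card_inj_on_le)
  then show ?thesis using r assms(1) by (simp add: card_Diff_singleton)
qed simp

text \<open>Deleting the closing edge of a cycle keeps the graph connected, because the rest of the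
  cycle is a detour; too few edges would remain.\<close>

lemma connected_graph_no_cycle:
  assumes "finite V" "finite E" "connected_graph V E" "card E + 1 \<le> card V"
  shows "\<not> is_cycle E vs"
proof
  assume cyc: "is_cycle E vs"
  define n where "n = length vs"
  have n: "3 \<le> n" and dist: "distinct vs"
    and step: "\<And>i. i < n \<Longrightarrow> {vs ! i, vs ! (Suc i mod n)} \<in> E"
    using cyc by (auto simp: is_cycle_def n_def)
  define e where "e = {vs ! (n - 1), vs ! 0}"
  let ?R = "\<lambda>E. {(x, y). {x, y} \<in> E}"
  have e: "e \<in> E" using step[of "n - 1"] n by (simp add: e_def)
  have path: "(vs ! 0, vs ! i) \<in> (?R (E - {e}))\<^sup>*" if "i < n" for i
    using that
  proof (induction i)
    case (Suc i)
    have "{vs ! i, vs ! Suc i} \<noteq> e"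
    proof
      assume "{vs ! i, vs ! Suc i} = e"
      then have "(vs ! i = vs ! 0 \<and> vs ! Suc i = vs ! (n - 1)) \<or> vs ! Suc i = vs ! 0"
        by (auto simp: e_def doubleton_eq_iff)
      moreover have "i < length vs" "Suc i < length vs" "0 < length vs" "n - 1 < length vs"
        using Suc.prems n by (auto simp: n_def)
      ultimately show False
        using n Suc.prems nth_eq_iff_index_eq[OF dist] by fastforce
    qed
    then have "(vs ! i, vs ! Suc i) \<in> ?R (E - {e})" using step[of i] Suc.prems by simp
    then show ?case using Suc by (auto intro: rtrancl_into_rtrancl)
  qed simp
  have sym: "sym ((?R (E - {e}))\<^sup>*)"
    by (intro sym_rtrancl) (auto simp: sym_def insert_commute)
  have last: "(vs ! 0, vs ! (n - 1)) \<in> (?R (E - {e}))\<^sup>*" using path[of "n - 1"] n by simp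
  have "?R E \<subseteq> (?R (E - {e}))\<^sup>*"
  proof clarify
    fix x y assume xy: "{x, y} \<in> E"
    show "(x, y) \<in> (?R (E - {e}))\<^sup>*"
    proof (cases "{x, y} = e")
      case True
      then have "(x, y) = (vs ! 0, vs ! (n - 1)) \<or> (y, x) = (vs ! 0, vs ! (n - 1))"
        by (auto simp: e_def doubleton_eq_iff)
      then show ?thesis using last symD[OF sym last] by auto
    next
      case False
      then show ?thesis using xy by auto
    qed
  qed
  then have "(?R E)\<^sup>* \<subseteq> (?R (E - {e}))\<^sup>*" by (metis rtrancl_mono rtrancl_idemp)
  then have "connected_graph V (E - {e})" using assms(3) unfolding connected_graph_def by blast
  then have "card V \<le> card (E - {e}) + 1" using assms by (intro connected_graph_card) auto
  moreover have "card (E - {e}) + 1 = card E"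
    using e assms(2) by (metis Suc_eq_plus1 card_Suc_Diff1)
  ultimately show False using assms(4) by linarith
qed

lemma connected_graph_cut:
  assumes "connected_graph V E" "u \<in> V" "v \<in> V" "u \<in> K" "v \<notin> K"
  obtains x y where "{x, y} \<in> E" "x \<in> K" "y \<notin> K"
proof -
  have "(u, v) \<in> {(x, y). {x, y} \<in> E}\<^sup>*" using assms by (auto simp: connected_graph_def)
  then have "v \<in> K \<or> (\<exists>x y. {x, y} \<in> E \<and> x \<in> K \<and> y \<notin> K)"
    using assms(4) by (induction rule: rtrancl_induct) blast+
  then show ?thesis using assms that by auto
qed

section \<open>Chains of gadgets\<close>

(* Gadget j is a 12-gon with local vertices -6, ..., 5; non-negative ones lie on one side of the
   chain, negative ones on the other. Gadgets j and j + 1 share the edge which is (-6, 5) for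
   gadget j and (-1, 0) for gadget j + 1. *)
definition pos :: "nat \<Rightarrow> int \<Rightarrow> int" where
  "pos j u = (if 0 \<le> u then u + 5 * int j else u - 5 * int j)"

definition gadget_edge :: "nat \<Rightarrow> int \<times> int \<Rightarrow> edge" where
  "gadget_edge j e = {pt (pos j (fst e)), pt (pos j (snd e))}"

text \<open>The glue edges are left out: \<open>slots\<close> adds \<open>(-1, 0)\<close>, and
  \<open>(-6, 5)\<close> is supplied by the next index. Without \<open>(-6, 5)\<close> the local
  depths of two endpoints sum to at most 9, which \<open>gadget_edge_eqD\<close> exploits.\<close>

definition own_edges :: "(int \<times> int) set" where
  "own_edges = {(a, b). -6 \<le> a \<and> a < b \<and> b \<le> 5} - {(-1, 0), (-6, 5)}"

text \<open>Each gadget brings its front glue edge; index \<open>k\<close> stands for the rear glue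
  edge of the last gadget, or for the single edge of an empty chain. Thus shared edges are listed
  only once.\<close>

definition slots :: "nat \<Rightarrow> (nat \<Rightarrow> (int \<times> int) set) \<Rightarrow> (nat \<times> int \<times> int) set" where
  "slots k G = insert (k, -1, 0) (SIGMA j:{..<k}. insert (-1, 0) (G j))"

definition chain :: "nat \<Rightarrow> (nat \<Rightarrow> (int \<times> int) set) \<Rightarrow> edge set" where
  "chain k G = case_prod gadget_edge ` slots k G"

definition rim :: "nat \<Rightarrow> int set" where
  "rim k = {- 5 * int k - 1..5 * int k}"

lemma pos_less_iff [simp]: "pos j u < pos j v \<longleftrightarrow> u < v"
  by (auto simp: pos_def)

lemma pos_eq_iff [simp]: "pos j u = pos j v \<longleftrightarrow> u = v"
  by (auto simp: pos_def)

lemma pos_in_rim: "j < k \<Longrightarrow> u \<in> {-6..5} \<Longrightarrow> pos j u \<in> rim k"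
  by (auto simp: pos_def rim_def)

lemma rim_cases:
  assumes "x \<in> rim k"
  obtains j u where "j < k" "u \<in> {-6..5}" "x = pos j u"
  | "x = pos k 0" | "x = pos k (-1)"
proof (cases "0 \<le> x")
  case True
  show thesis
  proof (cases "x = 5 * int k")
    case True
    then show thesis using that by (simp add: pos_def)
  next
    case False
    have "nat (x div 5) < k" "x mod 5 \<in> {-6..5}" "x = pos (nat (x div 5)) (x mod 5)"
      using True False assms by (auto simp: rim_def pos_def)
    then show thesis using that(1) by blast
  qed
next
  case neg: False
  define y where "y = -1 - x"
  have y: "0 \<le> y" "x = -1 - y" "y \<le> 5 * int k" using neg assms by (auto simp: y_def rim_def)
  show thesis
  proof (cases "y = 5 * int k")
    case True
    then show thesis using that y by (simp add: pos_def)
  next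
    case False
    define q r where "q = y div 5" and "r = y mod 5"
    have "y = 5 * q + r" "0 \<le> r" "r < 5" "0 \<le> q" using y by (auto simp: q_def r_def)
    then have "nat q < k" "-1 - r \<in> {-6..5}" "x = pos (nat q) (-1 - r)"
      using y False by (auto simp: pos_def)
    then show thesis using that(1) by blast
  qed
qed

lemma card_rim: "card (rim k) = 10 * k + 2"
  by (simp add: rim_def)

lemma gadget_edge_commute: "gadget_edge j (a, b) = gadget_edge j (b, a)"
  by (auto simp: gadget_edge_def)

lemma gadget_edge_glue: "gadget_edge j (-6, 5) = gadget_edge (Suc j) (-1, 0)"
  by (auto simp: gadget_edge_def pos_def)

definition depth :: "int \<Rightarrow> int" where
  "depth x = (if 0 \<le> x then x else - 1 - x)"

(* The sum of the depths of the endpoints of an edge, divided by 10, recovers the gadget. *)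
lemma gadget_edge_eqD:
  assumes eq: "gadget_edge j e = gadget_edge j' e'"
    and e: "e \<in> insert (-1, 0) own_edges" and e': "e' \<in> insert (-1, 0) own_edges"
  shows "j = j' \<and> e = e'"
proof -
  obtain a b where ab: "e = (a, b)" by fastforce
  obtain c d where cd: "e' = (c, d)" by fastforce
  have depth: "depth (pos i u) = depth u + 5 * int i" for i u by (simp add: depth_def pos_def)
  have *: "{pos j a, pos j b} = {pos j' c, pos j' d}"
    using eq by (auto simp: gadget_edge_def ab cd doubleton_eq_iff)
  then have "depth (pos j a) + depth (pos j b) = depth (pos j' c) + depth (pos j' d)"
    by (auto simp: doubleton_eq_iff)
  moreover have "0 \<le> depth a + depth b" "depth a + depth b < 10"
    "0 \<le> depth c + depth d" "depth c + depth d < 10"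
    using e e' by (auto simp: own_edges_def ab cd depth_def)
  ultimately have "j = j'" unfolding depth by linarith
  moreover have "a < b" "c < d" using e e' by (auto simp: own_edges_def ab cd)
  ultimately show ?thesis using * by (auto simp: ab cd doubleton_eq_iff)
qed

lemma inj_on_slots:
  assumes "\<And>j. j < k \<Longrightarrow> G j \<subseteq> own_edges"
  shows "inj_on (case_prod gadget_edge) (slots k G)"
  using assms by (fastforce simp: inj_on_def slots_def dest: gadget_edge_eqD)

section \<open>Chains of gadget trees are plane spanning trees\<close>

definition interleaved :: "int \<times> int \<Rightarrow> int \<times> int \<Rightarrow> bool" where
  "interleaved e f \<longleftrightarrow> fst e < fst f \<and> fst f < snd e \<and> snd e < snd f"

text \<open>Nine own edges and two glue edges are 11 edges on 12 vertices, so connectivity already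
  makes them a tree.\<close>

definition gadget_tree :: "(int \<times> int) set \<Rightarrow> bool" where
  "gadget_tree G \<longleftrightarrow> G \<subseteq> own_edges \<and> finite G \<and> card G = 9 \<and> (\<forall>e\<in>G. \<forall>f\<in>G. \<not> interleaved e f) \<and>
     (let R = G \<union> {(-1, 0), (-6, 5)} in \<forall>u\<in>{-6..5}. (0, u) \<in> (R \<union> R\<inverse>)\<^sup>*)"

lemma gadget_edge_crosses:
  "interleaved e f \<Longrightarrow> crosses (gadget_edge j e) (gadget_edge j f)"
  by (auto simp: interleaved_def gadget_edge_def intro: crosses_interleaved)

text \<open>Within one gadget this is the interleaving criterion; for \<open>j < j'\<close> no
  vertex of gadget \<open>j'\<close> lies strictly between the ends of an edge of gadget
  \<open>j\<close>.\<close>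

lemma gadget_edge_not_crosses:
  assumes "j \<le> j'" "e \<in> insert (-1, 0) own_edges" "f \<in> insert (-1, 0) own_edges"
    "j = j' \<Longrightarrow> e \<noteq> f \<and> \<not> interleaved e f \<and> \<not> interleaved f e"
  shows "\<not> crosses (gadget_edge j e) (gadget_edge j' f)"
proof -
  obtain a b where ab: "e = (a, b)" by fastforce
  obtain c d where cd: "f = (c, d)" by fastforce
  have le: "-6 \<le> a" "a < b" "b \<le> 5" "-6 \<le> c" "c < d" "d \<le> 5"
    using assms(2,3) by (auto simp: own_edges_def ab cd)
  have ne: "(pos j a, pos j b) \<noteq> (pos j' c, pos j' d)"
    using gadget_edge_eqD[of j e j' f] assms by (auto simp: gadget_edge_def ab cd)
  have far: "pos j' u \<le> pos j a \<or> pos j b \<le> pos j' u" if "j < j'" "-6 \<le> u" "u \<le> 5" for u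
    using that le by (auto simp: pos_def)
  have "\<not> (pos j a < pos j' c \<and> pos j' c < pos j b \<and> pos j b < pos j' d)"
    "\<not> (pos j' c < pos j a \<and> pos j a < pos j' d \<and> pos j' d < pos j b)"
    using far[of c] far[of d] le assms(1,4)
    by (cases "j = j'"; force simp: interleaved_def ab cd)+
  then show ?thesis
    using ne le unfolding gadget_edge_def ab cd by (intro not_crosses) auto
qed

text \<open>Counting slots gives at most \<open>10 * k + 1\<close> edges, and connectivity
  propagates through the shared edges. Then \<open>connected_graph_card\<close> makes the count
  exact and \<open>connected_graph_no_cycle\<close> excludes cycles.\<close>

lemma chain_plane_spanning_tree:
  assumes G: "\<And>j. j < k \<Longrightarrow> gadget_tree (G j)"
  shows "plane_spanning_tree (pt ` rim k) (chain k G)"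
proof -
  let ?V = "pt ` rim k" and ?E = "chain k G"
  have G_own: "G j \<subseteq> own_edges" if "j < k" for j using G[OF that] by (simp add: gadget_tree_def)
  have own: "e \<in> insert (-1, 0) own_edges" if "(j, e) \<in> slots k G" for j e
    using that G_own by (auto simp: slots_def)
  have jk: "j < k \<or> e = (-1, 0) \<and> j = k" if "(j, e) \<in> slots k G" for j e
    using that by (auto simp: slots_def)
  have cardV: "card ?V = 10 * k + 2"
    using card_image[OF inj_on_subset[OF inj_pt]] card_rim by simp
  have fin: "finite (slots k G)" using G by (auto simp: slots_def gadget_tree_def)
  have "card (slots k G) \<le> Suc (\<Sum>j<k. card (insert (-1, 0) (G j)))"
    unfolding slots_def using G
    by (intro order.trans[OF card_insert_le_m1] ) (auto simp: gadget_tree_def card_insert_if)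
  also have "\<dots> \<le> Suc (\<Sum>j<k. 10)"
    using G by (intro Suc_le_mono[THEN iffD2] sum_mono) (auto simp: gadget_tree_def card_insert_if)
  finally have cardE: "finite ?E" "card ?E + 1 \<le> card ?V"
    using fin card_image_le[OF fin, of "case_prod gadget_edge"] by (auto simp: chain_def cardV)
  have sub: "?E \<subseteq> edges_on ?V"
  proof
    fix x assume "x \<in> ?E"
    then obtain j a b where s: "(j, a, b) \<in> slots k G" "x = gadget_edge j (a, b)"
      by (auto simp: chain_def)
    have "a < b" "pos j a \<in> rim k" "pos j b \<in> rim k"
      using own[OF s(1)] jk[OF s(1)] pos_in_rim[of j k] by (auto simp: own_edges_def rim_def pos_def)
    then show "x \<in> edges_on ?V" unfolding s edges_on_def gadget_edge_def by fastforce
  qed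
  let ?R = "{(x, y). {x, y} \<in> ?E}"
  have symR: "sym (?R\<^sup>*)" by (intro sym_rtrancl) (auto simp: sym_def insert_commute)
  \<comment> \<open>The case \<open>j = k\<close> supplies the edge \<open>(-6, 5)\<close> of the
    last gadget.\<close>
  have glue: "gadget_edge j (-1, 0) \<in> ?E" if "j \<le> k" for j
    using that by (cases "j = k") (force simp: chain_def slots_def)+
  have path: "(pt (pos j 0), pt (pos j u)) \<in> ?R\<^sup>*" if "j < k" "u \<in> {-6..5}" for j u
  proof -
    let ?G = "G j \<union> {(-1, 0), (-6, 5)}"
    have step: "gadget_edge j (a, b) \<in> ?E" if "(a, b) \<in> ?G" for a b
      using that \<open>j < k\<close> glue[of j] glue[of "Suc j"] gadget_edge_glue[of j]
      by (force simp: chain_def slots_def)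
    have "(0, u) \<in> (?G \<union> ?G\<inverse>)\<^sup>*"
      using G[OF that(1)] that(2) by (auto simp: gadget_tree_def Let_def)
    then show ?thesis
    proof (induction rule: rtrancl_induct)
      case (step y z)
      then have "gadget_edge j (y, z) \<in> ?E"
        using \<open>\<And>a b. (a, b) \<in> ?G \<Longrightarrow> gadget_edge j (a, b) \<in> ?E\<close> by (metis UnE converseD gadget_edge_commute)
      then have "(pt (pos j y), pt (pos j z)) \<in> ?R" by (simp add: gadget_edge_def)
      then show ?case using step.IH by (rule rtrancl_into_rtrancl[rotated])
    qed simp
  qed
  have base: "(pt 0, pt (pos j 0)) \<in> ?R\<^sup>*" if "j \<le> k" for j
    using that
  proof (induction j)
    case (Suc j)
    \<comment> \<open>Consecutive gadgets share this vertex, so a path to it continues into the next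
      gadget.\<close>
    have "pos (Suc j) 0 = pos j 5" by (simp add: pos_def)
    then show ?case using Suc path[of j 5] by (auto intro: rtrancl_trans)
  qed (simp add: pos_def)
  have root: "(pt 0, pt x) \<in> ?R\<^sup>*" if "x \<in> rim k" for x
    using that
  proof (cases rule: rim_cases)
    case (1 j u)
    then show ?thesis using base[of j] path[of j u] by (auto intro: rtrancl_trans)
  next
    case 2
    then show ?thesis using base[of k] by simp
  next
    case 3
    have "(pt (pos k 0), pt (pos k (-1))) \<in> ?R"
      using glue[of k] by (simp add: gadget_edge_def insert_commute)
    then show ?thesis using base[of k] 3 by (auto intro: rtrancl_into_rtrancl)
  qed
  have conn: "connected_graph ?V ?E"
    unfolding connected_graph_def using root symR by (auto intro: rtrancl_trans dest: symD)
  have "pairwise (\<lambda>e f. \<not> crosses e f) ?E"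
  proof (rule pairwiseI)
    have noncross: "\<not> crosses (gadget_edge j e) (gadget_edge j' f)"
      if s: "(j, e) \<in> slots k G" "(j', f) \<in> slots k G" "(j, e) \<noteq> (j', f)" "j \<le> j'" for j e j' f
    proof (rule gadget_edge_not_crosses)
      assume "j = j'"
      have "\<not> interleaved e f \<and> \<not> interleaved f e"
      proof (cases "e = (-1, 0) \<or> f = (-1, 0)")
        case False
        then have "j < k" "e \<in> G j" "f \<in> G j" using s \<open>j = j'\<close> by (auto simp: slots_def)
        then show ?thesis using G by (auto simp: gadget_tree_def)
      qed (auto simp: interleaved_def)
      then show "e \<noteq> f \<and> \<not> interleaved e f \<and> \<not> interleaved f e" using s \<open>j = j'\<close> by auto
    qed (use s own in auto)
    fix x y assume "x \<in> ?E" "y \<in> ?E" "x \<noteq> y"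
    then obtain p q where pq: "p \<in> slots k G" "q \<in> slots k G"
      "x = case_prod gadget_edge p" "y = case_prod gadget_edge q" unfolding chain_def by blast
    obtain j e j' f where "p = (j, e)" "q = (j', f)" by (cases p, cases q) auto
    with pq have s: "(j, e) \<in> slots k G" "(j', f) \<in> slots k G"
      "x = gadget_edge j e" "y = gadget_edge j' f" by auto
    then show "\<not> crosses x y"
      using noncross[OF s(1,2)] noncross[OF s(2,1)] \<open>x \<noteq> y\<close> crosses_commute[of x y] linear[of j j']
      unfolding s(3,4) by blast
  qed
  moreover have "card ?E + 1 = card ?V"
    using connected_graph_card[OF _ cardE(1) conn] cardE(2) by (simp add: rim_def)
  moreover have "is_tree ?V ?E"
    using conn connected_graph_no_cycle[OF _ cardE(1) conn cardE(2)] by (simp add: is_tree_def rim_def)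
  ultimately show ?thesis using sub by (simp add: plane_spanning_tree_def)
qed

section \<open>Flip sequences along a chain\<close>

lemma chain_cong: "(\<And>j. j < k \<Longrightarrow> G j = G' j) \<Longrightarrow> chain k G = chain k G'"
  by (auto simp: chain_def slots_def intro!: arg_cong[of _ _ "\<lambda>S. case_prod gadget_edge ` S"])

text \<open>Slots determine edges uniquely, so an exchange in one gadget exchanges exactly one edge
  of the chain.\<close>

lemma chain_flip:
  assumes G: "\<And>j. j < k \<Longrightarrow> gadget_tree (G j)" and j: "j < k"
    and G': "gadget_tree (insert f (G j - {e}))" and e: "e \<in> G j" and f: "f \<notin> G j"
  shows "flip (pt ` rim k) (chain k G) (chain k (G(j := insert f (G j - {e}))))"
proof -
  let ?G' = "G(j := insert f (G j - {e}))"
  have own: "G i \<subseteq> own_edges" "?G' i \<subseteq> own_edges" if "i < k" for i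
    using G[OF that] G' by (auto simp: gadget_tree_def)
  have glue: "(-1, 0) \<noteq> e" "(-1, 0) \<noteq> f"
    using own[OF j] e by (auto simp: own_edges_def)
  have slots: "slots k ?G' = insert (j, f) (slots k G - {(j, e)})"
    using j e glue by (auto simp: slots_def split: if_splits)
  \<comment> \<open>Injectivity must cover the old and the new slot together, hence the family of
    unions below.\<close>
  let ?U = "insert (j, f) (slots k G)"
  have inj: "inj_on (case_prod gadget_edge) ?U"
  proof (rule inj_on_subset)
    show "inj_on (case_prod gadget_edge) (slots k (\<lambda>i. G i \<union> ?G' i))"
      by (rule inj_on_slots) (use own in blast)
    show "?U \<subseteq> slots k (\<lambda>i. G i \<union> ?G' i)" using j by (auto simp: slots_def)
  qed
  have mem: "(j, e) \<in> slots k G" "(j, f) \<notin> slots k G"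
    using j e f glue by (auto simp: slots_def)
  have "chain k ?G' = insert (gadget_edge j f) (chain k G - {gadget_edge j e})"
    unfolding chain_def slots using inj_on_image_set_diff[OF inj, of "slots k G" "{(j, e)}"] mem by auto
  moreover have "gadget_edge j e \<in> chain k G" using mem by (force simp: chain_def)
  moreover have "gadget_edge j f \<notin> chain k G"
    using inj_on_image_mem_iff[OF inj, of "(j, f)" "slots k G"] mem by (auto simp: chain_def)
  moreover have "plane_spanning_tree (pt ` rim k) (chain k ?G')"
    by (rule chain_plane_spanning_tree) (use G G' in auto)
  ultimately show ?thesis
    using chain_plane_spanning_tree[of k G] G unfolding flip_def by blast
qed

definition gadget_flips :: "(nat \<Rightarrow> (int \<times> int) set) \<Rightarrow> nat \<Rightarrow> bool" where
  "gadget_flips L n \<longleftrightarrow> (\<forall>i\<le>n. gadget_tree (L i)) \<and>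
     (\<forall>i<n. \<exists>e f. e \<in> L i \<and> f \<notin> L i \<and> L (Suc i) = insert f (L i - {e}))"

(* The gadgets are transformed one after the other. *)
definition relay :: "(nat \<Rightarrow> (int \<times> int) set) \<Rightarrow> nat \<Rightarrow> nat \<Rightarrow> nat \<Rightarrow> (int \<times> int) set" where
  "relay L n i j = L (min n (i - n * j))"

lemma chain_flip_sequence:
  assumes L: "gadget_flips L n" and n: "0 < n"
  shows "flip_sequence (pt ` rim k) (chain k (\<lambda>_. L 0)) (chain k (\<lambda>_. L n)) (n * k)
    (\<lambda>i. chain k (relay L n i))"
  unfolding flip_sequence_def
proof (intro conjI allI impI)
  have tree: "gadget_tree (relay L n i j)" for i j
    using L by (auto simp: relay_def gadget_flips_def)
  show "chain k (relay L n 0) = chain k (\<lambda>_. L 0)" by (simp add: relay_def[abs_def])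
  show "chain k (relay L n (n * k)) = chain k (\<lambda>_. L n)"
  proof (rule chain_cong)
    fix j assume "j < k"
    then have "n * Suc j \<le> n * k" by (intro mult_le_mono2) simp
    then have "n \<le> n * k - n * j" by simp
    then show "relay L n (n * k) j = L n" by (simp add: relay_def min_absorb1)
  qed
  show "plane_spanning_tree (pt ` rim k) (chain k (relay L n i))" for i
    by (rule chain_plane_spanning_tree) (rule tree)
  fix i assume i: "i < n * k"
  \<comment> \<open>Flip number \<open>i\<close> of the chain is flip number \<open>r\<close> of
    gadget \<open>j\<close>.\<close>
  define j r where "j = i div n" and "r = i mod n"
  have ijr: "i = n * j + r" "r < n" using n by (auto simp: j_def r_def)
  have jk: "j < k" using i n by (simp add: j_def less_mult_imp_div_less mult.commute)
  obtain e f where ef: "e \<in> L r" "f \<notin> L r" "L (Suc r) = insert f (L r - {e})"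
    using L ijr by (auto simp: gadget_flips_def)
  have r: "relay L n i j = L r" "relay L n (Suc i) j = L (Suc r)"
    using ijr by (simp_all add: relay_def)
  \<comment> \<open>In \<open>relay\<close>, \<open>min\<close> keeps earlier gadgets at stage
    \<open>n\<close>, and truncated subtraction keeps later ones at stage 0.\<close>
  have "relay L n (Suc i) j' = relay L n i j'" if "j' \<noteq> j" for j'
  proof (cases "j' < j")
    case True
    then have "n * Suc j' \<le> n * j" by (intro mult_le_mono2) simp
    then have "n \<le> i - n * j'" "n \<le> Suc i - n * j'" using ijr by simp_all
    then show ?thesis by (simp add: relay_def min_absorb1)
  next
    case False
    then have "n * Suc j \<le> n * j'" using that by (intro mult_le_mono2) simp
    then have "i - n * j' = 0" "Suc i - n * j' = 0" using ijr by simp_all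
    then show ?thesis by (simp add: relay_def)
  qed
  then have "relay L n (Suc i) = (relay L n i)(j := insert f (relay L n i j - {e}))"
    using r ef by (auto simp: fun_eq_iff)
  moreover have "flip (pt ` rim k) (chain k (relay L n i))
      (chain k ((relay L n i)(j := insert f (relay L n i j - {e}))))"
    using tree ef r jk by (intro chain_flip) (metis+)
  ultimately show "flip (pt ` rim k) (chain k (relay L n i)) (chain k (relay L n (Suc i)))" by simp
qed

section \<open>The gadget\<close>

text \<open>The other two common boundary edges are the glue edges, which the chain
  supplies.\<close>

definition common_edges :: "(int \<times> int) list" where
  "common_edges = [(2, 3), (-4, -3)]"

definition initial_edges :: "(int \<times> int) list" where
  "initial_edges = [(1, 3), (1, 4), (-6, 1), (-6, -1), (-5, -1), (-5, -2), (-4, -2)]"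

definition final_edges :: "(int \<times> int) list" where
  "final_edges = [(-2, 0), (-3, 1), (-2, 1), (-5, 2), (-3, 2), (-5, 4), (-5, 5)]"

definition early_parks :: "(int \<times> int) list" where
  "early_parks = [(0, 1), (-6, -5), (-2, -1), (4, 5)]"

definition late_parks :: "(int \<times> int) list" where
  "late_parks = [(-5, -4), (1, 2), (-3, -2), (3, 4)]"

text \<open>The common edges and the parks together are all boundary edges of the 12-gon except the
  two glue edges.\<close>

definition allowed_edges :: "(int \<times> int) list" where
  "allowed_edges = common_edges @ initial_edges @ final_edges @ early_parks @ late_parks"

section \<open>Executable checks of gadget trees and flips\<close>

definition spanned :: "(int \<times> int) list \<Rightarrow> int list \<Rightarrow> int list" where
  "spanned = fold (\<lambda>(a, b) S. if a \<in> set S then List.insert b S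
     else if b \<in> set S then List.insert a S else S)"

text \<open>One run of \<open>spanned\<close> uses the edges in list order and may meet an edge
  before either end is reached; six passes suffice for all trees checked below.\<close>

definition check_tree :: "(int \<times> int) list \<Rightarrow> bool" where
  "check_tree es \<longleftrightarrow> length es = 9 \<and> distinct es \<and>
     list_all (\<lambda>(a, b). -6 \<le> a \<and> a < b \<and> b \<le> 5 \<and> (a, b) \<noteq> (-1, 0) \<and> (a, b) \<noteq> (-6, 5)) es \<and>
     list_all (\<lambda>e. list_all (\<lambda>f. \<not> interleaved e f) es) es \<and>
     list_all (\<lambda>u. u \<in> set (spanned (concat (replicate 6 ((-1, 0) # (-6, 5) # es))) [0]))
       [-6..5]"

fun check_flips :: "(int \<times> int) list \<Rightarrow> ((int \<times> int) \<times> (int \<times> int)) list \<Rightarrow> bool" where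
  "check_flips es [] \<longleftrightarrow> check_tree es"
| "check_flips es ((e, f) # fs) \<longleftrightarrow>
     check_tree es \<and> e \<in> set es \<and> f \<notin> set es \<and> check_flips (f # remove1 e es) fs"

fun stage :: "(int \<times> int) list \<Rightarrow> ((int \<times> int) \<times> (int \<times> int)) list \<Rightarrow> nat \<Rightarrow> (int \<times> int) list" where
  "stage es ((e, f) # fs) (Suc i) = stage (f # remove1 e es) fs i"
| "stage es fs i = es"

text \<open>Adding the other end of an edge that has a reached end preserves reachability from
  0.\<close>

lemma spanned_sound:
  assumes "set es \<subseteq> R" "\<forall>u\<in>set S. (0, u) \<in> (R \<union> R\<inverse>)\<^sup>*"
  shows "\<forall>u\<in>set (spanned es S). (0, u) \<in> (R \<union> R\<inverse>)\<^sup>*"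
  using assms
proof (induction es arbitrary: S)
  case (Cons e es)
  obtain a b where e: "e = (a, b)" by fastforce
  then have "(a, b) \<in> R \<union> R\<inverse>" "(b, a) \<in> R \<union> R\<inverse>" using Cons.prems by auto
  then have "(0, a) \<in> (R \<union> R\<inverse>)\<^sup>* \<longleftrightarrow> (0, b) \<in> (R \<union> R\<inverse>)\<^sup>*"
    by (meson rtrancl.rtrancl_into_rtrancl)
  then have "\<forall>u\<in>set (if a \<in> set S then List.insert b S
     else if b \<in> set S then List.insert a S else S). (0, u) \<in> (R \<union> R\<inverse>)\<^sup>*"
    using Cons.prems by auto
  then show ?case using Cons.IH Cons.prems(1) by (simp add: spanned_def e)
qed (simp add: spanned_def)

lemma gadget_tree_check: "check_tree es \<Longrightarrow> gadget_tree (set es)"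
proof -
  assume c: "check_tree es"
  let ?R = "set es \<union> {(-1, 0), (-6, 5)}"
  let ?es = "concat (replicate 6 ((-1, 0) # (-6, 5) # es))"
  have "\<forall>u\<in>set (spanned ?es [0]). (0, u) \<in> (?R \<union> ?R\<inverse>)\<^sup>*"
    by (rule spanned_sound) auto
  moreover have "{-6..5} \<subseteq> set (spanned ?es [0])"
  proof
    fix u :: int assume "u \<in> {-6..5}"
    then have "u \<in> set [-6..5]" by (simp only: set_upto)
    then show "u \<in> set (spanned ?es [0])" using c unfolding check_tree_def list_all_iff by blast
  qed
  moreover have "set es \<subseteq> own_edges" using c by (auto simp: check_tree_def list_all_iff own_edges_def)
  moreover have "card (set es) = 9" using c by (auto simp: check_tree_def distinct_card)
  moreover have "\<forall>e\<in>set es. \<forall>f\<in>set es. \<not> interleaved e f"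
    using c by (simp add: check_tree_def list_all_iff)
  ultimately show ?thesis unfolding gadget_tree_def Let_def by blast
qed

lemma gadget_flips_check:
  "check_flips es fs \<Longrightarrow> gadget_flips (\<lambda>i. set (stage es fs i)) (length fs)"
proof (induction es fs rule: check_flips.induct)
  case (1 es)
  then show ?case by (simp add: gadget_flips_def gadget_tree_check)
next
  case (2 es e f fs)
  have es: "check_tree es" "e \<in> set es" "f \<notin> set es" using 2 by auto
  \<comment> \<open>Distinctness, part of \<open>check_tree\<close>, makes \<open>remove1\<close>
    agree with set difference.\<close>
  then have step: "set (f # remove1 e es) = insert f (set es - {e})" by (auto simp: check_tree_def)
  have IH: "gadget_flips (\<lambda>i. set (stage (f # remove1 e es) fs i)) (length fs)" using 2 by simp
  show ?case unfolding gadget_flips_def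
  proof (intro conjI allI impI)
    fix i assume "i \<le> length ((e, f) # fs)"
    then show "gadget_tree (set (stage es ((e, f) # fs) i))"
      using IH es gadget_tree_check by (cases i) (auto simp: gadget_flips_def)
  next
    fix i assume i: "i < length ((e, f) # fs)"
    let ?L = "\<lambda>i. set (stage es ((e, f) # fs) i)"
    show "\<exists>e f. e \<in> ?L i \<and> f \<notin> ?L i \<and> ?L (Suc i) = insert f (?L i - {e})"
    proof (cases i)
      case 0
      then show ?thesis using es step by (intro exI[of _ e] exI[of _ f]) simp
    next
      case (Suc i')
      then show ?thesis using IH i by (simp add: gadget_flips_def)
    qed
  qed
qed

lemma set_stage: "set (stage es fs i) \<subseteq> set es \<union> snd ` set fs"
proof (induction es fs i rule: stage.induct)
  case (1 es e f fs i)
  then show ?case using set_remove1_subset[of e es] by auto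
qed auto

text \<open>The diagonal \<open>(-5, 1)\<close> is parked by the first flip and removed by the last;
  all flips but the first insert final edges.\<close>

definition short_flips :: "((int \<times> int) \<times> (int \<times> int)) list" where
  "short_flips = [((-6, -1), (-5, 1)), ((-5, -1), (-2, 0)), ((-6, 1), (-5, 5)), ((1, 4), (-5, 4)),
     ((1, 3), (-5, 2)), ((-5, -2), (-2, 1)), ((-4, -2), (-3, 1)), ((-5, 1), (-3, 2))]"

text \<open>Parks the late edge \<open>(-3, -2)\<close> and the early edge \<open>(-2, -1)\<close>;
  the other seven flips insert final edges.\<close>

definition hull_flips :: "((int \<times> int) \<times> (int \<times> int)) list" where
  "hull_flips = [((-4, -2), (-3, -2)), ((-5, -1), (-2, -1)), ((-6, -1), (-2, 1)),
     ((-2, -1), (-2, 0)), ((-6, 1), (-5, 5)), ((1, 4), (-5, 4)), ((1, 3), (-5, 2)),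
     ((-5, -2), (-3, 2)), ((-3, -2), (-3, 1))]"

lemma check_short_flips: "check_flips (common_edges @ initial_edges) short_flips"
  by code_simp

lemma check_hull_flips: "check_flips (common_edges @ initial_edges) hull_flips"
  by code_simp

lemma final_stage:
  "set (stage (common_edges @ initial_edges) short_flips 8) = set (common_edges @ final_edges)"
  "set (stage (common_edges @ initial_edges) hull_flips 9) = set (common_edges @ final_edges)"
  by code_simp+

section \<open>Two hull edges are parked in every gadget\<close>

definition separates :: "int set \<Rightarrow> int \<times> int \<Rightarrow> bool" where
  "separates K e \<longleftrightarrow> (fst e \<in> K) \<noteq> (snd e \<in> K)"

text \<open>Nearest local vertex of gadget \<open>j\<close> on the same side of the chain; a left
  inverse of \<open>pos j\<close> on local vertices.\<close>

definition clamp :: "nat \<Rightarrow> int \<Rightarrow> int" where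
  "clamp j x = (if 0 \<le> x then max 0 (min 5 (x - 5 * int j)) else min (-1) (max (-6) (x + 5 * int j)))"

lemma clamp_pos: "u \<in> {-6..5} \<Longrightarrow> clamp j (pos j u) = u"
  by (auto simp: clamp_def pos_def)

lemma clamp_pos_less: "j' < j \<Longrightarrow> u \<in> {-6..5} \<Longrightarrow> clamp j (pos j' u) \<in> {-1, 0}"
  by (auto simp: clamp_def pos_def)

lemma clamp_pos_greater: "j < j' \<Longrightarrow> u \<in> {-6..5} \<Longrightarrow> clamp j (pos j' u) \<in> {-6, 5}"
  by (auto simp: clamp_def pos_def)

lemma allowed_own: "set allowed_edges \<subseteq> own_edges"
  by (auto simp: allowed_edges_def common_edges_def initial_edges_def final_edges_def
      early_parks_def late_parks_def own_edges_def)

(* Clamping collapses the rest of the chain onto the two ends of gadget j. *)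
lemma gadget_cut:
  assumes T: "T \<subseteq> chain k (\<lambda>_. A)" "A \<subseteq> own_edges" "connected_graph (pt ` rim k) T"
    and j: "j < k" and ends: "0 \<in> K \<longleftrightarrow> -1 \<in> K" "5 \<in> K \<longleftrightarrow> -6 \<in> K"
    and uv: "u \<in> {-6..5} \<inter> K" "v \<in> {-6..5} - K"
  obtains e where "e \<in> A" "gadget_edge j e \<in> T" "separates K e"
proof -
  define K' where "K' = pt ` {x. clamp j x \<in> K}"
  have K': "pt x \<in> K' \<longleftrightarrow> clamp j x \<in> K" for x by (auto simp: K'_def)
  have "pt (pos j u) \<in> pt ` rim k" "pt (pos j v) \<in> pt ` rim k" "pt (pos j u) \<in> K'" "pt (pos j v) \<notin> K'"
    using uv j pos_in_rim[of j k] by (auto simp: K' clamp_pos)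
  from connected_graph_cut[OF T(3) this] obtain x y where xy: "{x, y} \<in> T" "x \<in> K'" "y \<notin> K'" .
  then obtain j' a b where s: "(j', a, b) \<in> slots k (\<lambda>_. A)" "{x, y} = gadget_edge j' (a, b)"
    using T(1) by (auto simp: chain_def)
  then have "(pt (pos j' a) \<in> K') \<noteq> (pt (pos j' b) \<in> K')"
    using xy by (auto simp: gadget_edge_def doubleton_eq_iff)
  then have sep: "(clamp j (pos j' a) \<in> K) \<noteq> (clamp j (pos j' b) \<in> K)" by (simp add: K')
  have ab: "a \<in> {-6..5}" "b \<in> {-6..5}" "(a, b) = (-1, 0) \<or> (a, b) \<in> A"
    using s(1) T(2) by (auto simp: slots_def own_edges_def)
  have "j' = j"
  proof (rule ccontr)
    \<comment> \<open>Both ends of such an edge are clamped to ends of one glue edge of gadget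
      \<open>j\<close>, which \<open>K\<close> does not separate.\<close>
    assume "j' \<noteq> j"
    then consider "j' < j" | "j < j'" by linarith
    then show False
    proof cases
      case 1
      then show False using sep ends clamp_pos_less[OF 1 ab(1)] clamp_pos_less[OF 1 ab(2)] by auto
    next
      case 2
      then show False using sep ends clamp_pos_greater[OF 2 ab(1)] clamp_pos_greater[OF 2 ab(2)] by auto
    qed
  qed
  then have "separates K (a, b)" using sep ab by (simp add: clamp_pos separates_def)
  moreover from this have "(a, b) \<in> A" using ab(3) ends by (auto simp: separates_def)
  ultimately show thesis using that xy(1) s(2) \<open>j' = j\<close> by metis
qed

lemma gadget_edge_in_chain_iff:
  assumes "j < k" "e \<in> own_edges" "\<And>i. i < k \<Longrightarrow> G i \<subseteq> own_edges"
  shows "gadget_edge j e \<in> chain k G \<longleftrightarrow> e \<in> G j"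
proof
  assume "gadget_edge j e \<in> chain k G"
  then obtain i a b where s: "(i, a, b) \<in> slots k G" "gadget_edge j e = gadget_edge i (a, b)"
    by (auto simp: chain_def)
  moreover have "(a, b) \<in> insert (-1, 0) own_edges" using s(1) assms(3) by (auto simp: slots_def)
  ultimately have "j = i" "e = (a, b)" using gadget_edge_eqD assms(2) by blast+
  then show "e \<in> G j" using s(1) assms(1,2) by (auto simp: slots_def own_edges_def)
next
  assume "e \<in> G j"
  then show "gadget_edge j e \<in> chain k G" using assms(1) by (force simp: chain_def slots_def)
qed

lemma chain_mono: "(\<And>j. j < k \<Longrightarrow> G j \<subseteq> G' j) \<Longrightarrow> chain k G \<subseteq> chain k G'"
  unfolding chain_def by (intro image_mono) (force simp: slots_def)

text \<open>Hull edges join consecutive abscissae, except for the closing edge, which is the glue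
  edge of index \<open>k\<close>. Division by 5 finds the gadget of the others.\<close>

lemma hull_edge_in_chain:
  assumes "e \<in> hull_edges (pt ` rim k)"
  shows "e \<in> chain k (\<lambda>_. set allowed_edges)"
proof -
  let ?C = "chain k (\<lambda>_. set allowed_edges)"
  obtain a b where ab: "e = {pt a, pt b}" "a \<noteq> b" "a \<in> rim k" "b \<in> rim k"
    using assms by (auto simp: hull_edges_def edges_on_def)
  define x y where "x = min a b" and "y = max a b"
  have xy: "e = {pt x, pt y}" "x < y" "x \<in> rim k" "y \<in> rim k"
    using ab by (auto simp: x_def y_def min_def max_def)
  have glue: "gadget_edge j (-1, 0) \<in> ?C" if "j \<le> k" for j
    using that by (cases "j = k") (force simp: chain_def slots_def)+
  have own: "gadget_edge j f \<in> ?C" if "j < k" "f \<in> set allowed_edges" for j f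
    using that by (force simp: chain_def slots_def)
  have "y = x + 1 \<or> (x = - 5 * int k - 1 \<and> y = 5 * int k)"
    using hull_edge_cases[of x y "- 5 * int k - 1" "5 * int k"] assms xy by (auto simp: rim_def)
  then show ?thesis
  proof
    assume "x = - 5 * int k - 1 \<and> y = 5 * int k"
    then have "x = pos k (-1)" "y = pos k 0" by (simp_all add: pos_def)
    then have "e = gadget_edge k (-1, 0)" using xy by (simp add: gadget_edge_def)
    then show ?thesis using glue[of k] by simp
  next
    assume y: "y = x + 1"
    consider "x = -1" | "0 \<le> x" | "x \<le> -2" by linarith
    then show ?thesis
    proof cases
      case 1
      then have "e = gadget_edge 0 (-1, 0)" using xy y by (simp add: gadget_edge_def pos_def)
      then show ?thesis using glue[of 0] by simp
    next
      case 2
      define q r where "q = x div 5" and "r = x mod 5"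
      have qr: "x = 5 * q + r" "0 \<le> r" "r < 5" "0 \<le> q" using 2 by (auto simp: q_def r_def)
      then have "nat q < k" "e = gadget_edge (nat q) (r, r + 1)"
        using xy y by (auto simp: gadget_edge_def pos_def rim_def)
      moreover have "r = 0 \<or> r = 1 \<or> r = 2 \<or> r = 3 \<or> r = 4" using qr by linarith
      then have "(r, r + 1) \<in> set allowed_edges"
        by (auto simp: allowed_edges_def common_edges_def early_parks_def late_parks_def)
      ultimately show ?thesis using own by simp
    next
      case 3
      \<comment> \<open>The negative side is counted downwards from the edge \<open>(-2, -1)\<close>
        of gadget 0.\<close>
      define q r where "q = (-2 - x) div 5" and "r = (-2 - x) mod 5"
      have "-2 - x = 5 * q + r" by (simp add: q_def r_def)
      moreover have "0 \<le> r" "r < 5" "0 \<le> q" using 3 by (auto simp: q_def r_def)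
      ultimately have qr: "x = - 2 - 5 * q - r" "0 \<le> r" "r < 5" "0 \<le> q" by linarith+
      then have "nat q < k" "e = gadget_edge (nat q) (-2 - r, -1 - r)"
        using xy y by (auto simp: gadget_edge_def pos_def rim_def)
      moreover have "r = 0 \<or> r = 1 \<or> r = 2 \<or> r = 3 \<or> r = 4" using qr by linarith
      then have "(-2 - r, -1 - r) \<in> set allowed_edges"
        by (auto simp: allowed_edges_def common_edges_def early_parks_def late_parks_def)
      ultimately show ?thesis using own by simp
    qed
  qed
qed

text \<open>Deleting \<open>a\<close> splits the initial tree of the gadget, glue edges included,
  and \<open>K\<close> is one of the two parts. The hull edges leaving \<open>K\<close> are early
  parks, so without \<open>a\<close> and final edges only an early park can reconnect it.\<close>

lemma early_cut:
  assumes "a \<in> {(-6, -1), (-6, 1), (-5, -1)}"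
  obtains K :: "int set" where "0 \<in> K \<longleftrightarrow> -1 \<in> K" "5 \<in> K \<longleftrightarrow> -6 \<in> K" "-2 \<in> {-6..5} \<inter> K \<and> -6 \<in> {-6..5} - K \<or> 1 \<in> {-6..5} \<inter> K \<and> 0 \<in> {-6..5} - K"
    "\<And>e. e \<in> set allowed_edges \<Longrightarrow> separates K e \<Longrightarrow> e = a \<or> e \<in> set final_edges \<or> e \<in> set early_parks"
proof -
  define K :: "int set" where "K = (if a = (-6, -1) then set [-5, -4, -3, -2, -1, 0]
    else if a = (-6, 1) then set [1, 2, 3, 4] else set [-5, -4, -3, -2])"
  have "list_all (\<lambda>e. separates (set [-5, -4, -3, -2, -1, 0]) e \<longrightarrow> e = (-6, -1) \<or> e \<in> set final_edges \<or> e \<in> set early_parks) allowed_edges"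
    by code_simp
  moreover have "list_all (\<lambda>e. separates (set [1, 2, 3, 4]) e \<longrightarrow> e = (-6, 1) \<or> e \<in> set final_edges \<or> e \<in> set early_parks) allowed_edges"
    by code_simp
  moreover have "list_all (\<lambda>e. separates (set [-5, -4, -3, -2]) e \<longrightarrow> e = (-5, -1) \<or> e \<in> set final_edges \<or> e \<in> set early_parks) allowed_edges"
    by code_simp
  ultimately have "e = a \<or> e \<in> set final_edges \<or> e \<in> set early_parks" if "e \<in> set allowed_edges" "separates K e" for e
    using that assms unfolding K_def list_all_iff by fastforce
  then show thesis using assms by (intro that[of K]) (auto simp: K_def)
qed

text \<open>Here \<open>K\<close> is a part of the final tree with \<open>a\<close> deleted, and the
  hull edges leaving it are late parks.\<close>

lemma late_cut:
  assumes "a \<in> {(-3, 2), (-3, 1), (-5, 2)}"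
  obtains K :: "int set" where "0 \<in> K \<longleftrightarrow> -1 \<in> K" "5 \<in> K \<longleftrightarrow> -6 \<in> K" "0 \<in> {-6..5} \<inter> K \<and> -6 \<in> {-6..5} - K \<or> -6 \<in> {-6..5} \<inter> K \<and> 0 \<in> {-6..5} - K"
    "\<And>e. e \<in> set allowed_edges \<Longrightarrow> separates K e \<Longrightarrow> e = a \<or> e \<in> set initial_edges \<or> e \<in> set late_parks"
proof -
  define K :: "int set" where "K = (if a = (-3, 2) then set [-4, -3, -2, -1, 0, 1]
    else if a = (-3, 1) then set [-2, -1, 0, 1] else set [-6, -5, 4, 5])"
  have "list_all (\<lambda>e. separates (set [-4, -3, -2, -1, 0, 1]) e \<longrightarrow> e = (-3, 2) \<or> e \<in> set initial_edges \<or> e \<in> set late_parks) allowed_edges"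
    by code_simp
  moreover have "list_all (\<lambda>e. separates (set [-2, -1, 0, 1]) e \<longrightarrow> e = (-3, 1) \<or> e \<in> set initial_edges \<or> e \<in> set late_parks) allowed_edges"
    by code_simp
  moreover have "list_all (\<lambda>e. separates (set [-6, -5, 4, 5]) e \<longrightarrow> e = (-5, 2) \<or> e \<in> set initial_edges \<or> e \<in> set late_parks) allowed_edges"
    by code_simp
  ultimately have "e = a \<or> e \<in> set initial_edges \<or> e \<in> set late_parks" if "e \<in> set allowed_edges" "separates K e" for e
    using that assms unfolding K_def list_all_iff by fastforce
  then show thesis using assms by (intro that[of K]) (auto simp: K_def)
qed

lemma early_park:
  assumes "T \<subseteq> chain k (\<lambda>_. set allowed_edges)" "connected_graph (pt ` rim k) T" "j < k"
    and "a \<in> {(-6, -1), (-6, 1), (-5, -1)}" "gadget_edge j a \<notin> T"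
    and "\<And>f. f \<in> set final_edges \<Longrightarrow> gadget_edge j f \<notin> T"
  obtains e where "e \<in> set early_parks" "gadget_edge j e \<in> T"
proof -
  obtain K where K: "0 \<in> K \<longleftrightarrow> -1 \<in> K" "5 \<in> K \<longleftrightarrow> -6 \<in> K" "-2 \<in> {-6..5} \<inter> K \<and> -6 \<in> {-6..5} - K \<or> 1 \<in> {-6..5} \<inter> K \<and> 0 \<in> {-6..5} - K"
    "\<And>e. e \<in> set allowed_edges \<Longrightarrow> separates K e \<Longrightarrow> e = a \<or> e \<in> set final_edges \<or> e \<in> set early_parks"
    using early_cut[OF assms(4)] by metis
  obtain e where "e \<in> set allowed_edges" "gadget_edge j e \<in> T" "separates K e"
    using K(3) gadget_cut[OF assms(1) allowed_own assms(2,3) K(1,2)] by metis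
  then show thesis using that K(4) assms(5,6) by metis
qed

lemma late_park:
  assumes "T \<subseteq> chain k (\<lambda>_. set allowed_edges)" "connected_graph (pt ` rim k) T" "j < k"
    and "a \<in> {(-3, 2), (-3, 1), (-5, 2)}" "gadget_edge j a \<notin> T"
    and "\<And>f. f \<in> set initial_edges \<Longrightarrow> gadget_edge j f \<notin> T"
  obtains e where "e \<in> set late_parks" "gadget_edge j e \<in> T"
proof -
  obtain K where K: "0 \<in> K \<longleftrightarrow> -1 \<in> K" "5 \<in> K \<longleftrightarrow> -6 \<in> K" "0 \<in> {-6..5} \<inter> K \<and> -6 \<in> {-6..5} - K \<or> -6 \<in> {-6..5} \<inter> K \<and> 0 \<in> {-6..5} - K"
    "\<And>e. e \<in> set allowed_edges \<Longrightarrow> separates K e \<Longrightarrow> e = a \<or> e \<in> set initial_edges \<or> e \<in> set late_parks"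
    using late_cut[OF assms(4)] by metis
  obtain e where "e \<in> set allowed_edges" "gadget_edge j e \<in> T" "separates K e"
    using K(3) gadget_cut[OF assms(1) allowed_own assms(2,3) K(1,2)] by metis
  then show thesis using that K(4) assms(5,6) by metis
qed

lemma crossed_edge_notin:
  assumes "plane_spanning_tree P T" "gadget_edge j f \<in> T" "e \<noteq> f"
    "e \<in> own_edges" "f \<in> own_edges" "interleaved e f \<or> interleaved f e"
  shows "gadget_edge j e \<notin> T"
proof
  assume "gadget_edge j e \<in> T"
  moreover have "gadget_edge j e \<noteq> gadget_edge j f"
    using assms(3-5) gadget_edge_eqD by blast
  ultimately have "\<not> crosses (gadget_edge j e) (gadget_edge j f)"
    using assms(1,2) by (auto simp: plane_spanning_tree_def pairwise_def)
  then show False using assms(6) gadget_edge_crosses crosses_commute by blast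
qed

lemma flip_inserts_one:
  assumes "flip P T T'"
  shows "\<exists>g. T' \<subseteq> insert g T" "\<exists>g. T \<subseteq> insert g T'"
  using assms by (auto simp: flip_def)

section \<open>Lower bound for an arbitrary hull-parking flip sequence\<close>

context
  fixes k m T
  assumes seq: "hull_parking_flip_sequence (pt ` rim k)
    (chain k (\<lambda>_. set (common_edges @ initial_edges)))
    (chain k (\<lambda>_. set (common_edges @ final_edges))) m T"
begin

lemma seq_facts:
  "T 0 = chain k (\<lambda>_. set (common_edges @ initial_edges))"
  "T m = chain k (\<lambda>_. set (common_edges @ final_edges))"
  "i \<le> m \<Longrightarrow> plane_spanning_tree (pt ` rim k) (T i)"
  "i < m \<Longrightarrow> flip (pt ` rim k) (T i) (T (Suc i))"
  using seq by (auto simp: hull_parking_flip_sequence_def flip_sequence_def)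

lemma seq_allowed: "i \<le> m \<Longrightarrow> T i \<subseteq> chain k (\<lambda>_. set allowed_edges)"
proof
  fix e assume "i \<le> m" "e \<in> T i"
  then consider "e \<in> T 0" | "e \<in> T m" | "e \<in> hull_edges (pt ` rim k)"
    using seq seq_facts(1,2) by (auto simp: hull_parking_flip_sequence_def)
  then show "e \<in> chain k (\<lambda>_. set allowed_edges)"
  proof cases
    case 1
    then show ?thesis unfolding seq_facts(1) by (rule subsetD[OF chain_mono, rotated]) (auto simp: allowed_edges_def)
  next
    case 2
    then show ?thesis unfolding seq_facts(2) by (rule subsetD[OF chain_mono, rotated]) (auto simp: allowed_edges_def)
  qed (rule hull_edge_in_chain)
qed

lemma seq_connected: "i \<le> m \<Longrightarrow> connected_graph (pt ` rim k) (T i)"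
  using seq_facts(3) by (auto simp: plane_spanning_tree_def is_tree_def)

lemma initial_in_seq_0:
  "j < k \<Longrightarrow> e \<in> set allowed_edges \<Longrightarrow> gadget_edge j e \<in> T 0 \<longleftrightarrow> e \<in> set (common_edges @ initial_edges)"
  unfolding seq_facts(1) using allowed_own
  by (intro gadget_edge_in_chain_iff) (auto simp: allowed_edges_def)

lemma final_in_seq_m:
  "j < k \<Longrightarrow> e \<in> set allowed_edges \<Longrightarrow> gadget_edge j e \<in> T m \<longleftrightarrow> e \<in> set (common_edges @ final_edges)"
  unfolding seq_facts(2) using allowed_own
  by (intro gadget_edge_in_chain_iff) (auto simp: allowed_edges_def)

lemma missing_crossed_edge:
  assumes "i \<le> m" "gadget_edge j f \<in> T i" "e \<in> set allowed_edges" "f \<in> set allowed_edges"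
    "interleaved e f \<or> interleaved f e"
  shows "gadget_edge j e \<notin> T i"
  using assms allowed_own seq_facts(3)
  by (intro crossed_edge_notin[of _ _ _ f]) (auto simp: interleaved_def)

(* The first final edge to appear crosses (-6, -1) and one of (-6, 1), (-5, -1); a flip removes
   only one of them, so one is missing beforehand, when no final edge can bridge the cut. *)
lemma early_park_occurs:
  assumes j: "j < k"
  obtains i e where "i \<le> m" "e \<in> set early_parks" "gadget_edge j e \<in> T i"
proof -
  let ?N = "\<lambda>i. \<exists>f\<in>set final_edges. gadget_edge j f \<in> T i"
  have "?N m" "\<not> ?N 0"
    using final_in_seq_m[OF j] initial_in_seq_0[OF j]
    by (auto simp: allowed_edges_def common_edges_def initial_edges_def final_edges_def)
  then obtain i where i: "i < m" "\<not> ?N i" "?N (Suc i)"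
    using ex_least_nat_less[of ?N m] by blast
  then obtain f where f: "f \<in> set final_edges" "gadget_edge j f \<in> T (Suc i)" by blast
  have cross: "list_all (\<lambda>f. (interleaved (-6, -1) f \<or> interleaved f (-6, -1)) \<and>
      ((interleaved (-6, 1) f \<or> interleaved f (-6, 1)) \<or>
       (interleaved (-5, -1) f \<or> interleaved f (-5, -1)))) final_edges"
    by code_simp
  have allowed: "(-6, -1) \<in> set allowed_edges" "(-6, 1) \<in> set allowed_edges"
    "(-5, -1) \<in> set allowed_edges" "f \<in> set allowed_edges"
    using f(1) by (auto simp: allowed_edges_def initial_edges_def)
  have "gadget_edge j (-6, -1) \<notin> T (Suc i)"
    "gadget_edge j (-6, 1) \<notin> T (Suc i) \<or> gadget_edge j (-5, -1) \<notin> T (Suc i)"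
    using missing_crossed_edge[of "Suc i", OF _ f(2)] i(1) f(1) cross allowed
    unfolding list_all_iff by (metis Suc_leI)+
  moreover obtain g where "T i \<subseteq> insert g (T (Suc i))"
    using flip_inserts_one(2)[OF seq_facts(4)[OF i(1)]] by blast
  moreover have "gadget_edge j (-6, -1) \<noteq> gadget_edge j (-6, 1)"
    "gadget_edge j (-6, -1) \<noteq> gadget_edge j (-5, -1)"
    by (auto dest!: gadget_edge_eqD simp: own_edges_def)
  ultimately have "gadget_edge j (-6, -1) \<notin> T i \<or> gadget_edge j (-6, 1) \<notin> T i \<or> gadget_edge j (-5, -1) \<notin> T i"
    by blast
  then obtain a where "a \<in> {(-6, -1), (-6, 1), (-5, -1)}" "gadget_edge j a \<notin> T i"
    by blast
  then obtain e where "e \<in> set early_parks" "gadget_edge j e \<in> T i"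
    using early_park[of "T i" k j a] i j seq_allowed seq_connected by (metis less_imp_le)
  then show thesis using that i(1) by (meson less_imp_le)
qed

text \<open>The time-reversed argument. The last initial edge before \<open>Suc i\<close> crosses
  \<open>(-3, 2)\<close> and one of \<open>(-3, 1)\<close>, \<open>(-5, 2)\<close>. The flip that
  removes it adds only one edge, so one of the three is still missing when no initial edge can
  bridge the cut.\<close>

lemma late_park_occurs:
  assumes j: "j < k"
  obtains i e where "i \<le> m" "e \<in> set late_parks" "gadget_edge j e \<in> T i"
proof -
  let ?N = "\<lambda>i. \<not> (\<exists>f\<in>set initial_edges. gadget_edge j f \<in> T i)"
  have "?N m" "\<not> ?N 0"
    using final_in_seq_m[OF j] initial_in_seq_0[OF j]
    by (auto simp: allowed_edges_def common_edges_def initial_edges_def final_edges_def)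
  then obtain i where i: "i < m" "\<not> ?N i" "?N (Suc i)"
    using ex_least_nat_less[of ?N m] by blast
  then obtain f where f: "f \<in> set initial_edges" "gadget_edge j f \<in> T i" by blast
  have cross: "list_all (\<lambda>f. (interleaved (-3, 2) f \<or> interleaved f (-3, 2)) \<and>
      ((interleaved (-3, 1) f \<or> interleaved f (-3, 1)) \<or>
       (interleaved (-5, 2) f \<or> interleaved f (-5, 2)))) initial_edges"
    by code_simp
  have allowed: "(-3, 2) \<in> set allowed_edges" "(-3, 1) \<in> set allowed_edges"
    "(-5, 2) \<in> set allowed_edges" "f \<in> set allowed_edges"
    using f(1) by (auto simp: allowed_edges_def final_edges_def)
  have "gadget_edge j (-3, 2) \<notin> T i"
    "gadget_edge j (-3, 1) \<notin> T i \<or> gadget_edge j (-5, 2) \<notin> T i"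
    using missing_crossed_edge[of i, OF _ f(2)] i(1) f(1) cross allowed
    unfolding list_all_iff by (metis less_imp_le)+
  moreover obtain g where "T (Suc i) \<subseteq> insert g (T i)"
    using flip_inserts_one(1)[OF seq_facts(4)[OF i(1)]] by blast
  moreover have "gadget_edge j (-3, 2) \<noteq> gadget_edge j (-3, 1)"
    "gadget_edge j (-3, 2) \<noteq> gadget_edge j (-5, 2)"
    by (auto dest!: gadget_edge_eqD simp: own_edges_def)
  ultimately have "gadget_edge j (-3, 2) \<notin> T (Suc i) \<or> gadget_edge j (-3, 1) \<notin> T (Suc i) \<or> gadget_edge j (-5, 2) \<notin> T (Suc i)"
    by blast
  then obtain a where "a \<in> {(-3, 2), (-3, 1), (-5, 2)}" "gadget_edge j a \<notin> T (Suc i)"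
    by blast
  then obtain e where "e \<in> set late_parks" "gadget_edge j e \<in> T (Suc i)"
    using late_park[of "T (Suc i)" k j a] i j seq_allowed seq_connected by (metis Suc_leI)
  then show thesis using that i(1) by (meson Suc_leI)
qed

text \<open>A flip brings in at most one edge. Counting every edge that ever occurs charges a parked
  edge even if it is removed again.\<close>

lemma card_new_edges: "n \<le> m \<Longrightarrow> finite ((\<Union>i\<le>n. T i) - T 0) \<and> card ((\<Union>i\<le>n. T i) - T 0) \<le> n"
proof (induction n)
  case (Suc n)
  let ?D = "(\<Union>i\<le>n. T i) - T 0"
  obtain g where "T (Suc n) \<subseteq> insert g (T n)"
    using flip_inserts_one(1)[OF seq_facts(4)[of n]] Suc.prems by auto
  then have sub: "(\<Union>i\<le>Suc n. T i) - T 0 \<subseteq> insert g ?D" by (auto simp: atMost_Suc)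
  have IH: "finite ?D" "card ?D \<le> n" using Suc by auto
  have "card ((\<Union>i\<le>Suc n. T i) - T 0) \<le> card (insert g ?D)" using IH by (intro card_mono sub) auto
  also have "\<dots> \<le> Suc n" using IH by (simp add: card_insert_if)
  finally show ?case using finite_subset[OF sub] IH by simp
qed simp

text \<open>Each gadget contributes its seven final edges, an early park and a late park, none of
  them in \<open>T 0\<close>; contributions of different gadgets are disjoint.\<close>

lemma hull_parking_length: "9 * k \<le> m"
proof -
  have "\<exists>D. D \<subseteq> set allowed_edges \<and> card D = 9 \<and>
      gadget_edge j ` D \<subseteq> (\<Union>i\<le>m. T i) - T 0" if j: "j < k" for j
  proof -
    obtain i e where e: "i \<le> m" "e \<in> set early_parks" "gadget_edge j e \<in> T i"
      using early_park_occurs[OF j] .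
    obtain i' l where l: "i' \<le> m" "l \<in> set late_parks" "gadget_edge j l \<in> T i'"
      using late_park_occurs[OF j] .
    let ?D = "insert e (insert l (set final_edges))"
    have sub: "?D \<subseteq> set allowed_edges" using e l by (auto simp: allowed_edges_def)
    \<comment> \<open>Checks all 16 pairs of an early and a late park, since the pair that occurs is
      unknown.\<close>
    have "list_all (\<lambda>e. list_all (\<lambda>l. distinct (e # l # final_edges) \<and>
        list_all (\<lambda>f. f \<notin> set (common_edges @ initial_edges)) (e # l # final_edges)) late_parks) early_parks"
      by code_simp
    then have "distinct (e # l # final_edges) \<and>
        list_all (\<lambda>f. f \<notin> set (common_edges @ initial_edges)) (e # l # final_edges)"
      using e(2) l(2) unfolding list_all_iff[of _ early_parks] list_all_iff[of _ late_parks] by blast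
    then have dist: "distinct (e # l # final_edges)"
      and new: "f \<in> ?D \<Longrightarrow> f \<notin> set (common_edges @ initial_edges)" for f
      by (simp_all add: list_all_iff) blast
    have "card ?D = 9" using distinct_card[OF dist] by (simp add: final_edges_def)
    moreover have "?D \<inter> set (common_edges @ initial_edges) = {}" using new by blast
    then have "gadget_edge j ` ?D \<inter> T 0 = {}" using initial_in_seq_0[OF j] sub by blast
    moreover have "gadget_edge j ` set final_edges \<subseteq> T m"
      using final_in_seq_m[OF j] sub by auto
    then have "gadget_edge j ` ?D \<subseteq> (\<Union>i\<le>m. T i)" using e l by auto
    ultimately show ?thesis using sub by blast
  qed
  then obtain D where D: "\<And>j. j < k \<Longrightarrow> D j \<subseteq> set allowed_edges" "\<And>j. j < k \<Longrightarrow> card (D j) = 9"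
    "\<And>j. j < k \<Longrightarrow> gadget_edge j ` D j \<subseteq> (\<Union>i\<le>m. T i) - T 0" by metis
  let ?S = "SIGMA j:{..<k}. D j"
  have fin: "finite (D j)" if "j < k" for j using D(1)[OF that] finite_subset by blast
  have "inj_on (case_prod gadget_edge) ?S"
  proof (rule inj_on_subset)
    show "inj_on (case_prod gadget_edge) (slots k D)"
      using D(1) allowed_own by (intro inj_on_slots) blast
  qed (auto simp: slots_def)
  then have "card (case_prod gadget_edge ` ?S) = card ?S" by (rule card_image)
  also have "\<dots> = (\<Sum>j<k. card (D j))" using fin by (intro card_SigmaI) auto
  also have "\<dots> = 9 * k" using D(2) by simp
  finally have "card (case_prod gadget_edge ` ?S) = 9 * k" .
  moreover have "case_prod gadget_edge ` ?S \<subseteq> (\<Union>i\<le>m. T i) - T 0" using D(3) by auto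
  ultimately have "9 * k \<le> card ((\<Union>i\<le>m. T i) - T 0)"
    using card_new_edges[of m] card_mono[of "(\<Union>i\<le>m. T i) - T 0" "case_prod gadget_edge ` ?S"] by simp
  also have "\<dots> \<le> m" using card_new_edges[of m] by simp
  finally show ?thesis .
qed

end

section \<open>Explicit sequences and the resulting gap\<close>

lemma length_flips: "length short_flips = 8" "length hull_flips = 9"
  by (simp_all add: short_flips_def hull_flips_def)

lemma stage_0: "stage es fs 0 = es"
  by (cases fs) auto

lemma is_minimum_LEAST: "m \<in> A \<Longrightarrow> is_minimum A (LEAST m. m \<in> A)"
  by (auto simp: is_minimum_def intro: LeastI Least_le)

text \<open>Parks have endpoints with consecutive abscissae and are therefore hull edges; all other
  edges of the allowed chain, including glue edges, occur in one of the two end trees.\<close>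

lemma allowed_chain_cases:
  assumes "x \<in> chain k (\<lambda>_. set allowed_edges)"
  shows "x \<in> chain k (\<lambda>_. set (common_edges @ initial_edges)) \<union> chain k (\<lambda>_. set (common_edges @ final_edges)) \<or>
    x \<in> hull_edges (pt ` rim k)"
proof -
  obtain j e where s: "(j, e) \<in> slots k (\<lambda>_. set allowed_edges)"
    "x = gadget_edge j e" using assms by (auto simp: chain_def)
  show ?thesis
  proof (cases "j < k \<and> e \<in> set early_parks \<union> set late_parks")
    case True
    then have e: "snd e = fst e + 1" "0 \<le> fst e \<or> snd e < 0" "fst e \<in> {-6..5}" "snd e \<in> {-6..5}"
      by (auto simp: early_parks_def late_parks_def)
    then have "pos j (snd e) = pos j (fst e) + 1" by (auto simp: pos_def)
    moreover have "pos j (fst e) \<in> rim k" "pos j (snd e) \<in> rim k" using True e pos_in_rim by auto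
    ultimately show ?thesis using hull_edge_consecutive[of "pos j (fst e)" "rim k"] s(2)
      by (simp add: gadget_edge_def)
  next
    case False
    then have "(j, e) \<in> slots k (\<lambda>_. set (common_edges @ initial_edges)) \<union> slots k (\<lambda>_. set (common_edges @ final_edges))"
      using s(1) by (auto simp: slots_def allowed_edges_def)
    then show ?thesis using s(2) by (force simp: chain_def)
  qed
qed

theorem theorem6:
  shows "\<exists>TI TF :: nat \<Rightarrow> edge set. \<forall>k. \<exists>P.
    finite P \<and> card P = 10 * k + 2 \<and> convex_position P \<and>
    plane_spanning_tree P (TI k) \<and> plane_spanning_tree P (TF k) \<and>
    (\<exists>d d_hull. is_min_flip_length P (TI k) (TF k) d \<and>
       is_min_hull_parking_flip_length P (TI k) (TF k) d_hull \<and>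
       d_hull \<ge> d + k)"
proof -
  define TI where "TI k = chain k (\<lambda>_. set (common_edges @ initial_edges))" for k
  define TF where "TF k = chain k (\<lambda>_. set (common_edges @ final_edges))" for k
  have *: "finite P \<and> card P = 10 * k + 2 \<and> convex_position P \<and>
    plane_spanning_tree P (TI k) \<and> plane_spanning_tree P (TF k) \<and>
    (\<exists>d d_hull. is_min_flip_length P (TI k) (TF k) d \<and>
       is_min_hull_parking_flip_length P (TI k) (TF k) d_hull \<and> d_hull \<ge> d + k)"
    if P: "P = pt ` rim k" for k P
  proof -
    let ?short = "\<lambda>i. set (stage (common_edges @ initial_edges) short_flips i)"
    let ?hull = "\<lambda>i. set (stage (common_edges @ initial_edges) hull_flips i)"
    have short: "flip_sequence P (TI k) (TF k) (8 * k) (\<lambda>i. chain k (relay ?short 8 i))"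
      using chain_flip_sequence[OF gadget_flips_check[OF check_short_flips], of k]
      unfolding length_flips stage_0 final_stage P TI_def TF_def by simp
    have long: "flip_sequence P (TI k) (TF k) (9 * k) (\<lambda>i. chain k (relay ?hull 9 i))"
      using chain_flip_sequence[OF gadget_flips_check[OF check_hull_flips], of k]
      unfolding length_flips stage_0 final_stage P TI_def TF_def by simp
    \<comment> \<open>Each stage consists of initial, common and inserted edges, and the inserted
      ones are final edges or parks.\<close>
    have stages: "?hull i \<subseteq> set allowed_edges" for i
      using set_stage[of "common_edges @ initial_edges" hull_flips i]
      by (rule order.trans) (auto simp: hull_flips_def allowed_edges_def final_edges_def early_parks_def late_parks_def)
    have "hull_parking_flip_sequence P (TI k) (TF k) (9 * k) (\<lambda>i. chain k (relay ?hull 9 i))"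
      unfolding hull_parking_flip_sequence_def
    proof (intro conjI long allI impI ballI)
      fix i x assume "x \<in> chain k (relay ?hull 9 i)"
      then have "x \<in> chain k (\<lambda>_. set allowed_edges)"
        by (rule subsetD[OF chain_mono, rotated]) (use stages in \<open>auto simp: relay_def\<close>)
      then show "x \<in> TI k \<union> TF k \<or> x \<in> hull_edges P"
        using allowed_chain_cases by (simp add: TI_def TF_def P)
    qed
    \<comment> \<open>The explicit sequence shows that the set of lengths is nonempty, so its least
      element is attained.\<close>
    then have hull: "is_min_hull_parking_flip_length P (TI k) (TF k)
        (LEAST m. m \<in> {m. \<exists>T. hull_parking_flip_sequence P (TI k) (TF k) m T})"
      unfolding is_min_hull_parking_flip_length_def by (intro is_minimum_LEAST) blast
    have min: "is_min_flip_length P (TI k) (TF k) (LEAST m. m \<in> {m. \<exists>T. flip_sequence P (TI k) (TF k) m T})"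
      unfolding is_min_flip_length_def using short by (intro is_minimum_LEAST) blast
    \<comment> \<open>At most \<open>8 * k\<close> flips without the restriction against at least
      \<open>9 * k\<close> with it gives the gap \<open>k\<close>.\<close>
    have "(LEAST m. m \<in> {m. \<exists>T. flip_sequence P (TI k) (TF k) m T}) \<le> 8 * k"
      using short by (intro Least_le) blast
    moreover have "9 * k \<le> d" if "is_min_hull_parking_flip_length P (TI k) (TF k) d" for d
      using that hull_parking_length
      by (auto simp: is_min_hull_parking_flip_length_def is_minimum_def TI_def TF_def P)
    ultimately have "\<exists>d d_hull. is_min_flip_length P (TI k) (TF k) d \<and>
       is_min_hull_parking_flip_length P (TI k) (TF k) d_hull \<and> d_hull \<ge> d + k"
      using hull min by (intro exI conjI) (assumption | force)+
    moreover have "finite P" "card P = 10 * k + 2"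
      using card_image[OF inj_on_subset[OF inj_pt], of "rim k"] card_rim by (auto simp: P rim_def)
    moreover have "plane_spanning_tree P (TI k)" "plane_spanning_tree P (TF k)"
      using short by (auto simp: flip_sequence_def)
    ultimately show ?thesis using convex_position_parabola P by blast
  qed
  show ?thesis by (intro exI[of _ TI] exI[of _ TF] allI exI) (rule *[OF refl])
qed

end
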